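(* The controlled state trajectory $\boldsymbol{x}(t)$ of the affine control system $\dot{\boldsymbol{x}}(t)=\boldsymbol{R}(\boldsymbol{x}(t))+\boldsymbol{\mathcal{B}}(\boldsymbol{x}(t))\boldsymbol{u}(t)$ with initial condition $\boldsymbol{x}(t_0)=\boldsymbol{x}_0$ follows the desired trajectory $\boldsymbol{x}_d(t)$ exactly, i.e. $\boldsymbol{x}(t)=\boldsymbol{x}_d(t)$ for all times $t_0\le t\le t_1$, if and only if all of the following three conditions hold: (1) $\boldsymbol{x}_d(t)$ satisfies the constraint equation $\boldsymbol{\mathcal{Q}}(\boldsymbol{x}_d(t))\left(\dot{\boldsymbol{x}}_d(t)-\boldsymbol{R}(\boldsymbol{x}_d(t))\right)=\boldsymbol{0}$; (2) the initial value $\boldsymbol{x}_d(t_0)$ equals the initial value $\boldsymbol{x}_0$ of the controlled state equation, $\boldsymbol{x}_d(t_0)=\boldsymbol{x}_0$; (3) the control signal enforcing $\boldsymbol{x}_d(t)$ is given by $\boldsymbol{u}(t)=\boldsymbol{\mathcal{B}}^{+}(\boldsymbol{x}_d(t))\left(\dot{\boldsymbol{x}}_d(t)-\boldsymbol{R}(\boldsymbol{x}_d(t))\right)$.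
   Context: Here $\boldsymbol{x}(t)\in\mathbb{R}^n$ is the state, $\boldsymbol{u}(t)\in\mathbb{R}^p$ with $p\le n$ is the control signal, $\boldsymbol{R}(\boldsymbol{x})\in\mathbb{R}^n$ is the nonlinearity, $\boldsymbol{x}_0\in\mathbb{R}^n$ is the initial state, and a dot denotes the time derivative. The $n\times p$ input matrix $\boldsymbol{\mathcal{B}}(\boldsymbol{x})$ may depend on the state and is assumed to have full rank, $\operatorname{rank}\boldsymbol{\mathcal{B}}(\boldsymbol{x})=p$ for all $\boldsymbol{x}\in\mathbb{R}^n$. The controlled state trajectory $\boldsymbol{x}(t)$ is the trajectory which the state traces out under the action of the control signal $\boldsymbol{u}(t)$; the desired trajectory $\boldsymbol{x}_d(t)\in\mathbb{R}^n$ is a reference trajectory for the state over the time interval $t_0\le t\le t_1$, prescribed by the experimenter. The Moore-Penrose pseudo inverse of $\boldsymbol{\mathcal{B}}(\boldsymbol{x})$ is the $p\times n$ matrix $\boldsymbol{\mathcal{B}}^{+}(\boldsymbol{x})=\left(\boldsymbol{\mathcal{B}}^T(\boldsymbol{x})\boldsymbol{\mathcal{B}}(\boldsymbol{x})\right)^{-1}\boldsymbol{\mathcal{B}}^T(\boldsymbol{x})$, and the Moore-Penrose projectors are the $n\times n$ matrices $\boldsymbol{\mathcal{P}}(\boldsymbol{x})=\boldsymbol{\mathcal{B}}(\boldsymbol{x})\boldsymbol{\mathcal{B}}^{+}(\boldsymbol{x})$ and $\boldsymbol{\mathcal{Q}}(\boldsymbol{x})=\boldsymbol{1}-\boldsymbol{\mathcal{P}}(\boldsymbol{x})$,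 where $\boldsymbol{1}$ is the $n\times n$ identity matrix.
   Formalization: The controlled state trajectory is assumed to be the unique solution of the initial value problem on the interval (without uniqueness the "if" direction fails, e.g. R(y)=2√|y|, B=1, u=0, x_0=0); the desired trajectory is assumed differentiable and t_0<t_1. *)

theory Defs
  imports "HOL-Analysis.Analysis"
begin

text \<open>\<^const>\<open>matrix_inv\<close> is only meaningful on invertible matrices; \<open>transpose A ** A\<close> is
  invertible exactly when \<open>A\<close> has full column rank.\<close>

definition moore_penrose :: "real ^ 'p ^ 'n \<Rightarrow> real ^ 'n ^ 'p" where
  "moore_penrose A = matrix_inv (transpose A ** A) ** transpose A"

definition projector_P :: "real ^ 'p ^ 'n \<Rightarrow> real ^ 'n ^ 'n" where
  "projector_P A = A ** moore_penrose A"

definition projector_Q :: "real ^ 'p ^ 'n \<Rightarrow> real ^ 'n ^ 'n" where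
  "projector_Q A = mat 1 - projector_P A"

text \<open>Classical solutions on \<open>{t0..t1}\<close>; the derivative is one-sided at the two end points, and
  values of \<open>u\<close> and \<open>x\<close> outside \<open>{t0..t1}\<close> play no role.\<close>

definition solves_controlled_ivp ::
  "(real ^ 'n \<Rightarrow> real ^ 'n) \<Rightarrow> (real ^ 'n \<Rightarrow> real ^ 'p ^ 'n) \<Rightarrow> real \<Rightarrow> real \<Rightarrow> real ^ 'n \<Rightarrow>
   (real \<Rightarrow> real ^ 'p) \<Rightarrow> (real \<Rightarrow> real ^ 'n) \<Rightarrow> bool" where
  "solves_controlled_ivp R B t0 t1 x0 u x \<longleftrightarrow>
     x t0 = x0 \<and>
     (\<forall>t\<in>{t0..t1}. (x has_vector_derivative (R (x t) + B (x t) *v u t)) (at t within {t0..t1}))"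

end

theory Submission
  imports Defs
begin

text \<open>Fix a time \<open>t\<close> and write \<open>A\<close> for the input matrix at the desired state, \<open>v\<close> for
  the desired velocity minus \<open>R\<close>, and \<open>w\<close> for the control. When \<open>A\<close> has
  full column rank, its pseudo inverse is a left inverse, and this makes the single equation \<open>v = A w\<close> equivalent to the pair ``\<open>v\<close> is annihilated by
  the complementary projector, and \<open>w\<close> is the pseudo inverse applied to \<open>v\<close>''
  (\<open>eq_mult_iff_projector_Q_and_moore_penrose\<close>). The first condition is solvability of
  \<open>v = A w\<close> for \<open>w\<close>, the second picks out the unique solution.

  Read at every time, the constraint equation together with the control law is therefore just the
  statement that \<open>x\<^sub>d\<close> satisfies the controlled differential equation
  (\<open>solves_controlled_ivp_iff\<close>). So the three conditions say that \<open>x\<^sub>d\<close> solves the initial value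
  problem. Exact tracking implies this because \<open>x\<close> is a solution, and is implied by it because
  solutions are unique.\<close>

text \<open>The kernels of \<open>A\<^sup>T A\<close> and \<open>A\<close> coincide, since \<open>y \<bullet> A\<^sup>T A y\<close> is the squared norm of \<open>A y\<close>.
  Full column rank makes this kernel trivial, which suffices because \<open>A\<^sup>T A\<close> is square.\<close>

lemma invertible_gram_matrix:
  fixes A :: "real ^ 'p ^ 'n"
  assumes "rank A = CARD('p)"
  shows "invertible (transpose A ** A)"
proof -
  have inj: "inj ((*v) A)"
    using assms by (simp add: full_rank_injective)
  have "y = 0" if "(transpose A ** A) *v y = 0" for y
  proof -
    have "(A *v y) \<bullet> (A *v y) = y \<bullet> ((transpose A ** A) *v y)"
      by (simp add: dot_lmul_matrix [symmetric] matrix_vector_mul_assoc [symmetric]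
          inner_commute)
    then have "A *v y = 0"
      using that by simp
    then show "y = 0"
      using inj by (metis injD matrix_vector_mult_0_right)
  qed
  then show ?thesis
    by (simp add: invertible_left_inverse matrix_left_invertible_ker)
qed

lemma moore_penrose_left_inverse:
  fixes A :: "real ^ 'p ^ 'n"
  assumes "rank A = CARD('p)"
  shows "moore_penrose A ** A = mat 1"
proof -
  have "matrix_inv (transpose A ** A) ** (transpose A ** A) = mat 1"
    using someI_ex [OF invertible_gram_matrix [OF assms, unfolded invertible_def]]
    by (simp add: matrix_inv_def)
  then show ?thesis
    by (simp add: moore_penrose_def matrix_mul_assoc)
qed

text \<open>The projector condition reads \<open>v = A (A\<^sup>+ v)\<close>, so substituting \<open>w = A\<^sup>+ v\<close> gives \<open>v = A w\<close>;
  conversely, applying the left inverse \<open>A\<^sup>+\<close> to \<open>v = A w\<close> recovers \<open>w\<close>.\<close>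

lemma eq_mult_iff_projector_Q_and_moore_penrose:
  fixes A :: "real ^ 'p ^ 'n"
  assumes "rank A = CARD('p)"
  shows "v = A *v w \<longleftrightarrow> projector_Q A *v v = 0 \<and> w = moore_penrose A *v v"
proof -
  have "projector_Q A *v v = v - A *v (moore_penrose A *v v)"
    by (simp add: projector_Q_def projector_P_def matrix_vector_mult_diff_rdistrib
        matrix_vector_mul_assoc)
  moreover have "moore_penrose A *v (A *v w) = w"
    by (simp add: matrix_vector_mul_assoc moore_penrose_left_inverse [OF assms])
  ultimately show ?thesis
    by auto
qed

text \<open>On a nondegenerate interval the one-sided derivatives at the end points are unique as well, so
  the differential equation can be stated as an equation for \<open>vector_derivative\<close>.\<close>

lemma has_vector_derivative_within_interval_iff:
  fixes f :: "real \<Rightarrow> 'a::real_normed_vector"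
  assumes "a < b" and "f differentiable_on {a..b}" and "t \<in> {a..b}"
  shows "(f has_vector_derivative f') (at t within {a..b}) \<longleftrightarrow>
    vector_derivative f (at t within {a..b}) = f'"
proof
  assume "(f has_vector_derivative f') (at t within {a..b})"
  then show "vector_derivative f (at t within {a..b}) = f'"
    using vector_derivative_within_cbox [OF \<open>a < b\<close>] assms(3) by (simp add: cbox_interval)
next
  assume "vector_derivative f (at t within {a..b}) = f'"
  moreover have "f differentiable (at t within {a..b})"
    using assms(2,3) by (simp add: differentiable_on_def)
  ultimately show "(f has_vector_derivative f') (at t within {a..b})"
    by (simp add: vector_derivative_works)
qed

text \<open>Applies the pointwise equivalence at every time, with the derivative of \<open>y\<close> minus \<open>R\<close> as the
  vector to be reached by the control.\<close>

lemma solves_controlled_ivp_iff: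
  fixes B :: "real ^ 'n \<Rightarrow> real ^ 'p ^ 'n"
  assumes full_rank: "\<And>t. t \<in> {t0..t1} \<Longrightarrow> rank (B (y t)) = CARD('p)"
    and "t0 < t1"
    and diff: "y differentiable_on {t0..t1}"
  shows "solves_controlled_ivp R B t0 t1 x0 u y \<longleftrightarrow>
    (\<forall>t\<in>{t0..t1}. projector_Q (B (y t)) *v
        (vector_derivative y (at t within {t0..t1}) - R (y t)) = 0) \<and>
    y t0 = x0 \<and>
    (\<forall>t\<in>{t0..t1}. u t = moore_penrose (B (y t)) *v
        (vector_derivative y (at t within {t0..t1}) - R (y t)))"
proof -
  have "(y has_vector_derivative (R (y t) + B (y t) *v u t)) (at t within {t0..t1}) \<longleftrightarrow>
      projector_Q (B (y t)) *v (vector_derivative y (at t within {t0..t1}) - R (y t)) = 0 \<and>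
      u t = moore_penrose (B (y t)) *v (vector_derivative y (at t within {t0..t1}) - R (y t))"
    if t: "t \<in> {t0..t1}" for t
    unfolding has_vector_derivative_within_interval_iff [OF \<open>t0 < t1\<close> diff t]
      eq_mult_iff_projector_Q_and_moore_penrose [OF full_rank [OF t], symmetric]
    by (auto simp: algebra_simps)
  then show ?thesis
    unfolding solves_controlled_ivp_def by blast
qed

lemma solves_controlled_ivp_cong:
  assumes "t0 \<le> t1" and eq: "\<And>t. t \<in> {t0..t1} \<Longrightarrow> x t = y t"
    and sol: "solves_controlled_ivp R B t0 t1 x0 u x"
  shows "solves_controlled_ivp R B t0 t1 x0 u y"
  unfolding solves_controlled_ivp_def
proof (intro conjI ballI)
  show "y t0 = x0"
    using assms by (simp add: solves_controlled_ivp_def)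
next
  fix t assume t: "t \<in> {t0..t1}"
  have "(x has_vector_derivative (R (y t) + B (y t) *v u t)) (at t within {t0..t1})"
    using sol t unfolding solves_controlled_ivp_def eq [OF t, symmetric] by blast
  then show "(y has_vector_derivative (R (y t) + B (y t) *v u t)) (at t within {t0..t1})"
    by (rule has_vector_derivative_transform [OF t, rotated]) (simp add: eq)
qed

theorem theorem2:
  fixes R :: "real ^ 'n \<Rightarrow> real ^ 'n"
    and B :: "real ^ 'n \<Rightarrow> real ^ 'p ^ 'n"
    and u :: "real \<Rightarrow> real ^ 'p"
    and x xd :: "real \<Rightarrow> real ^ 'n"
    and x0 :: "real ^ 'n"
    and t0 t1 :: real
  assumes "CARD('p) \<le> CARD('n)"
    and full_rank: "\<And>y. rank (B y) = CARD('p)"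
    and "t0 < t1"
    and xd_diff: "xd differentiable_on {t0..t1}"
    and trajectory: "solves_controlled_ivp R B t0 t1 x0 u x"
    and trajectory_unique:
      "\<And>y. solves_controlled_ivp R B t0 t1 x0 u y \<Longrightarrow> \<forall>t\<in>{t0..t1}. y t = x t"
  shows "(\<forall>t\<in>{t0..t1}. x t = xd t) \<longleftrightarrow>
    (\<forall>t\<in>{t0..t1}. projector_Q (B (xd t)) *v
        (vector_derivative xd (at t within {t0..t1}) - R (xd t)) = 0) \<and>
    xd t0 = x0 \<and>
    (\<forall>t\<in>{t0..t1}. u t = moore_penrose (B (xd t)) *v
        (vector_derivative xd (at t within {t0..t1}) - R (xd t)))"
proof -
  have "(\<forall>t\<in>{t0..t1}. x t = xd t) \<longleftrightarrow> solves_controlled_ivp R B t0 t1 x0 u xd"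
  proof
    assume "\<forall>t\<in>{t0..t1}. x t = xd t"
    then show "solves_controlled_ivp R B t0 t1 x0 u xd"
      using solves_controlled_ivp_cong [OF _ _ trajectory] \<open>t0 < t1\<close> by simp
  next
    assume "solves_controlled_ivp R B t0 t1 x0 u xd"
    then show "\<forall>t\<in>{t0..t1}. x t = xd t"
      using trajectory_unique by fastforce
  qed
  then show ?thesis
    using solves_controlled_ivp_iff [where B = B and y = xd, OF full_rank \<open>t0 < t1\<close> xd_diff] by simp
qed

end
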